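(* The CE-based decomposition is an interaction decomposition. That is, fix for each $j\in D$ a representative value $\mathrm{Rep}_j\in\mathcal{X}_j$, put $\mathrm{Rep}_J=(\mathrm{Rep}_j)_{j\in J}$, and for $\emptyset\neq J\subseteq D$ and $g\in V_D$ let $$\mathcal{L}_{J,\mathrm{CE}}(g)(\mathbf{x}_J):=\mathbb{E}\left[{}_J\Delta_{\mathrm{Rep}_J}(g)(\mathbf{x}_J,\mathbf{X}_{\setminus J})\,\middle|\,\mathbf{X}_J=\mathbf{x}_J\right].$$ Then the family of linear operators $\{\mathcal{H}_{J,\mathrm{CE}}:V_D\to V_J\}_{J\subseteq D}$ defined recursively by $$\mathcal{H}_{\emptyset,\mathrm{CE}}:=\mathbb{E},\qquad \mathcal{H}_{J,\mathrm{CE}}:=\Big(I-\sum_{J'\subsetneq J}\mathcal{H}_{J',\mathrm{CE}}\Big)\circ\mathcal{L}_{J,\mathrm{CE}}\quad(J\neq\emptyset)$$ is an interaction decomposition.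
   Context: Setting. Let $d\ge 1$, $D=\{1,\dots,d\}$, and let $\mathbf{X}_D=(X_1,\dots,X_d)$ be a random vector of real feature variables (possibly dependent), each $X_j$ having compactly supported distribution. Let $\mathcal{X}_j\subset\mathbb{R}$ be the nonempty compact set of values that the variable $x_j$ can take, with $X_j\in\mathcal{X}_j$. $V_D$ is the real vector space of bounded measurable functions $g$ on $\prod_{j\in D}\mathcal{X}_j$; for $J\subseteq D$, $V_J\subseteq V_D$ is the subspace of functions depending only on the variables $\mathbf{x}_J=(x_j)_{j\in J}$, and $V_\emptyset=\mathbb{R}$ (constants). Thus $V_{J'}\subseteq V_J$ if $J'\subseteq J$, and any operators $V_D\to V_J$ and $V_D\to V_{J'}$ can be composed (written $\circ$). Put $\setminus J:=D\setminus J$. Operators. $I$ is the identity of $V_D$; $\mathbb{E}:V_D\to\mathbb{R}$, $\mathbb{E}(g)=\mathbb{E}[g(\mathbf{X}_D)]$; $\mathbb{E}_{\mathbf{X}_{\setminus J}}:V_D\to V_J$, $\mathbb{E}_{\mathbf{X}_{\setminus J}}(g)(\mathbf{x}_J)=\mathbb{E}[g(\mathbf{x}_J,\mathbf{X}_{\setminus J})]$ (expectation over the marginal law of $\mathbf{X}_{\setminus J}$, with $\mathbf{x}_J$ fixed). Conditional expectations are computed with a fixed regular conditional distribution $\kappa_J(\mathbf{x}_J,\cdot)$ of $\mathbf{X}_{\setminus J}$ given $\mathbf{X}_J=\mathbf{x}_J$, defined for all $\mathbf{x}_J\in\prod_{j\in J}\mathcal{X}_j$: $\mathbb{E}[\varphi(\mathbf{x}_J,\mathbf{X}_{\setminus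 J})\mid\mathbf{X}_J=\mathbf{x}_J]=\int\varphi(\mathbf{x}_J,\mathbf{y})\,\kappa_J(\mathbf{x}_J,d\mathbf{y})$; when $X_1,\dots,X_d$ are independent, $\kappa_J(\mathbf{x}_J,\cdot)$ is the unconditional law of $\mathbf{X}_{\setminus J}$. Differences. Let $g|_{\mathbf{x}_J=\mathbf{c}}$ denote substitution of $\mathbf{c}$ for $\mathbf{x}_J$ in $g$, and put ${}_J\Delta_{\mathbf{a}_J}(g)=\sum_{J'\subseteq J}(-1)^{|J'|}g|_{\mathbf{x}_{J'}=\mathbf{a}_{J'}}$ (the composition over $j\in J$ of the operators $g\mapsto g-g|_{x_j=a_j}$). "$\frac{\partial g}{\partial \mathbf{x}_J}=0$" means by definition (no differentiability assumed) that ${}_J\Delta_{\mathbf{a}_J}(g)=0$ identically for every $\mathbf{a}_J\in\prod_{j\in J}\mathcal{X}_j$. A family of linear operators $\{\mathcal{H}_J:V_D\to V_J\}_{J\subseteq D}$ is an interaction decomposition (ID) if, for all $J,J'\subseteq D$: (P1) Unbiasedness: $\mathcal{H}_\emptyset=\mathbb{E}$ and $\mathbb{E}\circ\mathcal{H}_J=0$ for $J\neq\emptyset$. (P2) Relevance: for $g\in V_D$, if $\frac{\partial g}{\partial\mathbf{x}_J}=0$, then $\mathcal{H}_J(g)=0$. (P3) Lean Decomposability: if $g\in V_J$, then $\big(\sum_{J'\subseteq J}\mathcal{H}_{J'}\big)(g)=g$. (P4) Idempotence: $\mathcal{H}_J\circ\mathcal{H}_J=\mathcal{H}_J$. (P5)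 Operational Orthogonality: if $J'\neq J$, then $\mathcal{H}_{J'}\circ\mathcal{H}_J=0$. (P6) Consistency with PD: when all feature variables $X_1,\dots,X_d$ are independent, $\sum_{J'\subseteq J}\mathcal{H}_{J'}=\mathbb{E}_{\mathbf{X}_{\setminus J}}$. *)

theory Defs
  imports "HOL-Probability.Probability"
begin

text \<open>
  A point of \<open>\<Prod>j\<in>J. Xs j\<close> is an extensional function in \<open>Pi\<^sub>E J Xs\<close>, with the product of the
  Borel sigma-algebras of the sets \<open>Xs j\<close>.
\<close>

abbreviation feature_space :: "(nat \<Rightarrow> real set) \<Rightarrow> nat set \<Rightarrow> (nat \<Rightarrow> real) measure" where
  "feature_space Xs J \<equiv> Pi\<^sub>M J (\<lambda>j. restrict_space borel (Xs j))"

abbreviation feature_vec :: "(nat \<Rightarrow> 'w \<Rightarrow> real) \<Rightarrow> nat set \<Rightarrow> 'w \<Rightarrow> nat \<Rightarrow> real" where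
  "feature_vec X J \<omega> \<equiv> (\<lambda>j\<in>J. X j \<omega>)"

text \<open>
  A real function on \<open>Pi\<^sub>E D Xs\<close> is represented by its extension by zero, so that functions which
  agree on \<open>Pi\<^sub>E D Xs\<close> are equal and the spaces below are real vector spaces under the pointwise
  operations.
\<close>

definition on_dom :: "nat set \<Rightarrow> (nat \<Rightarrow> real set) \<Rightarrow> ((nat \<Rightarrow> real) \<Rightarrow> real) \<Rightarrow> (nat \<Rightarrow> real) \<Rightarrow> real" where
  "on_dom D Xs g x = (if x \<in> Pi\<^sub>E D Xs then g x else 0)"

definition V :: "nat set \<Rightarrow> (nat \<Rightarrow> real set) \<Rightarrow> nat set \<Rightarrow> ((nat \<Rightarrow> real) \<Rightarrow> real) set" where
  "V D Xs J = {g. g \<in> borel_measurable (feature_space Xs D)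
      \<and> bounded (g ` Pi\<^sub>E D Xs)
      \<and> (\<forall>x. x \<notin> Pi\<^sub>E D Xs \<longrightarrow> g x = 0)
      \<and> (\<forall>x\<in>Pi\<^sub>E D Xs. \<forall>y\<in>Pi\<^sub>E D Xs. (\<forall>j\<in>J. x j = y j) \<longrightarrow> g x = g y)}"

definition linear_operator ::
  "((nat \<Rightarrow> real) \<Rightarrow> real) set \<Rightarrow> ((nat \<Rightarrow> real) \<Rightarrow> real) set
    \<Rightarrow> (((nat \<Rightarrow> real) \<Rightarrow> real) \<Rightarrow> (nat \<Rightarrow> real) \<Rightarrow> real) \<Rightarrow> bool" where
  "linear_operator S T F \<longleftrightarrow> F ` S \<subseteq> T
      \<and> (\<forall>a b. \<forall>g\<in>S. \<forall>h\<in>S. F (\<lambda>x. a * g x + b * h x) = (\<lambda>x. a * F g x + b * F h x))"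

text \<open>
  \<open>expect_out M D Xs X J\<close> averages over the unconditional law of the variables outside \<open>J\<close>; the
  variables in \<open>J\<close> are kept. Scalars are identified with constant functions on \<open>Pi\<^sub>E D Xs\<close>.
\<close>

definition expect :: "'w measure \<Rightarrow> nat set \<Rightarrow> (nat \<Rightarrow> real set) \<Rightarrow> (nat \<Rightarrow> 'w \<Rightarrow> real)
    \<Rightarrow> ((nat \<Rightarrow> real) \<Rightarrow> real) \<Rightarrow> (nat \<Rightarrow> real) \<Rightarrow> real" where
  "expect M D Xs X g = on_dom D Xs (\<lambda>x. \<integral>\<omega>. g (feature_vec X D \<omega>) \<partial>M)"

definition expect_out :: "'w measure \<Rightarrow> nat set \<Rightarrow> (nat \<Rightarrow> real set) \<Rightarrow> (nat \<Rightarrow> 'w \<Rightarrow> real) \<Rightarrow> nat set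
    \<Rightarrow> ((nat \<Rightarrow> real) \<Rightarrow> real) \<Rightarrow> (nat \<Rightarrow> real) \<Rightarrow> real" where
  "expect_out M D Xs X J g =
     on_dom D Xs (\<lambda>x. \<integral>\<omega>. g (merge J (D - J) (x, feature_vec X (D - J) \<omega>)) \<partial>M)"

text \<open>\<open>override_on x a J'\<close> is the point \<open>x\<close> with \<open>a\<close> substituted for its coordinates in \<open>J'\<close>.\<close>

definition diff_op :: "nat set \<Rightarrow> (nat \<Rightarrow> real) \<Rightarrow> ((nat \<Rightarrow> real) \<Rightarrow> real) \<Rightarrow> (nat \<Rightarrow> real) \<Rightarrow> real" where
  "diff_op J a g x = (\<Sum>J'\<in>Pow J. (- 1) ^ card J' * g (override_on x a J'))"

definition partial_zero :: "nat set \<Rightarrow> (nat \<Rightarrow> real set) \<Rightarrow> nat set \<Rightarrow> ((nat \<Rightarrow> real) \<Rightarrow> real) \<Rightarrow> bool" where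
  "partial_zero D Xs J g \<longleftrightarrow> (\<forall>a\<in>Pi\<^sub>E J Xs. \<forall>x\<in>Pi\<^sub>E D Xs. diff_op J a g x = 0)"

definition interaction_decomposition ::
  "'w measure \<Rightarrow> nat set \<Rightarrow> (nat \<Rightarrow> real set) \<Rightarrow> (nat \<Rightarrow> 'w \<Rightarrow> real)
    \<Rightarrow> (nat set \<Rightarrow> ((nat \<Rightarrow> real) \<Rightarrow> real) \<Rightarrow> (nat \<Rightarrow> real) \<Rightarrow> real) \<Rightarrow> bool" where
  "interaction_decomposition M D Xs X H \<longleftrightarrow>
     (\<forall>J\<subseteq>D. linear_operator (V D Xs D) (V D Xs J) (H J))
   \<and> \<comment> \<open>Unbiasedness\<close>
     (\<forall>g\<in>V D Xs D. H {} g = expect M D Xs X g)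
   \<and> (\<forall>J\<subseteq>D. J \<noteq> {} \<longrightarrow> (\<forall>g\<in>V D Xs D. expect M D Xs X (H J g) = (\<lambda>x. 0)))
   \<and> \<comment> \<open>Relevance\<close>
     (\<forall>J\<subseteq>D. \<forall>g\<in>V D Xs D. partial_zero D Xs J g \<longrightarrow> H J g = (\<lambda>x. 0))
   \<and> \<comment> \<open>Lean Decomposability\<close>
     (\<forall>J\<subseteq>D. \<forall>g\<in>V D Xs J. (\<lambda>x. \<Sum>J'\<in>Pow J. H J' g x) = g)
   \<and> \<comment> \<open>Idempotence\<close>
     (\<forall>J\<subseteq>D. \<forall>g\<in>V D Xs D. H J (H J g) = H J g)
   \<and> \<comment> \<open>Operational Orthogonality\<close>
     (\<forall>J\<subseteq>D. \<forall>J'\<subseteq>D. J' \<noteq> J \<longrightarrow> (\<forall>g\<in>V D Xs D. H J' (H J g) = (\<lambda>x. 0)))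
   \<and> \<comment> \<open>Consistency with PD\<close>
     (prob_space.indep_vars M (\<lambda>_. borel) X D \<longrightarrow>
       (\<forall>J\<subseteq>D. \<forall>g\<in>V D Xs D. (\<lambda>x. \<Sum>J'\<in>Pow J. H J' g x) = expect_out M D Xs X J g))"

definition regular_cond_distr ::
  "'w measure \<Rightarrow> nat set \<Rightarrow> (nat \<Rightarrow> real set) \<Rightarrow> (nat \<Rightarrow> 'w \<Rightarrow> real) \<Rightarrow> nat set
    \<Rightarrow> ((nat \<Rightarrow> real) \<Rightarrow> (nat \<Rightarrow> real) measure) \<Rightarrow> bool" where
  "regular_cond_distr M D Xs X J k \<longleftrightarrow>
     k \<in> feature_space Xs J \<rightarrow>\<^sub>M prob_algebra (feature_space Xs (D - J))
   \<and> (\<forall>A\<in>sets (feature_space Xs J). \<forall>B\<in>sets (feature_space Xs (D - J)).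
        measure M {\<omega> \<in> space M. feature_vec X J \<omega> \<in> A \<and> feature_vec X (D - J) \<omega> \<in> B}
          = (\<integral>\<omega>. indicator A (feature_vec X J \<omega>) * measure (k (feature_vec X J \<omega>)) B \<partial>M))"

definition L_CE ::
  "nat set \<Rightarrow> (nat \<Rightarrow> real set) \<Rightarrow> (nat set \<Rightarrow> (nat \<Rightarrow> real) \<Rightarrow> (nat \<Rightarrow> real) measure) \<Rightarrow> (nat \<Rightarrow> real)
    \<Rightarrow> nat set \<Rightarrow> ((nat \<Rightarrow> real) \<Rightarrow> real) \<Rightarrow> (nat \<Rightarrow> real) \<Rightarrow> real" where
  "L_CE D Xs \<kappa> r J g =
     on_dom D Xs (\<lambda>x. \<integral>y. diff_op J (restrict r J) g (merge J (D - J) (x, y)) \<partial>\<kappa> J (restrict x J))"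

text \<open>Only finite \<open>J\<close> matter; the value for infinite \<open>J\<close> is a dummy that makes the recursion total.\<close>

function H_CE ::
  "'w measure \<Rightarrow> nat set \<Rightarrow> (nat \<Rightarrow> real set) \<Rightarrow> (nat \<Rightarrow> 'w \<Rightarrow> real)
    \<Rightarrow> (nat set \<Rightarrow> (nat \<Rightarrow> real) \<Rightarrow> (nat \<Rightarrow> real) measure) \<Rightarrow> (nat \<Rightarrow> real)
    \<Rightarrow> nat set \<Rightarrow> ((nat \<Rightarrow> real) \<Rightarrow> real) \<Rightarrow> (nat \<Rightarrow> real) \<Rightarrow> real" where
  "H_CE M D Xs X \<kappa> r J g =
     (if J = {} then expect M D Xs X g
      else if finite J then
        (\<lambda>x. L_CE D Xs \<kappa> r J g x
             - (\<Sum>J'\<in>{J'. J' \<subset> J}. H_CE M D Xs X \<kappa> r J' (L_CE D Xs \<kappa> r J g) x))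
      else (\<lambda>x. 0))"
  by pat_completeness auto
termination
  by (relation "Wellfounded.measure (\<lambda>(M, D, Xs, X, \<kappa>, r, J, g). card J)") (auto intro: psubset_card_mono)

declare H_CE.simps [simp del]

end

theory Submission
  imports Defs
begin

text \<open>
  Write \<open>C\<^sub>J\<close> for the average over the kernel \<open>\<kappa> J\<close> and \<open>R\<^sub>J = I - (\<Sum>J' \<subset> J. H\<^sub>J')\<close>, so that
  \<open>H\<^sub>J = R\<^sub>J \<circ> L\<^sub>J\<close>. Expanding the difference operator, \<open>L\<^sub>J g\<close> is \<open>C\<^sub>J g\<close> plus terms
  \<open>C\<^sub>J (g|x\<^sub>K = r\<^sub>K)\<close> for nonempty \<open>K \<subseteq> J\<close>; if \<open>g\<close> depends only on \<open>x\<^sub>J\<close>, then \<open>C\<^sub>J\<close> acts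
  trivially and these terms depend on fewer variables. Lean decomposability for smaller sets
  together with relevance says that \<open>R\<^sub>J\<close> kills functions of fewer variables, so \<open>H\<^sub>J g = R\<^sub>J g\<close>, which
  is lean decomposability for \<open>J\<close>. Orthogonality and idempotence follow by induction, and
  unbiasedness is orthogonality to \<open>H\<^sub>\<emptyset>\<close>. Under independence \<open>C\<^sub>J\<close> is the unconditional average
  \<open>E\<^sub>J\<close>, so the extra terms lose variables for every \<open>g\<close> and \<open>H\<^sub>J = H\<^sub>J \<circ> E\<^sub>J\<close>. With the tower property
  \<open>E\<^sub>K \<circ> E\<^sub>J = E\<^sub>K\<close> for \<open>K \<subseteq> J\<close>, lean decomposability applied to \<open>E\<^sub>J g\<close> gives consistency with PD.
\<close>

section \<open>Linear operators and the function spaces \<open>V D Xs J\<close>\<close>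

lemma linear_operatorD:
  assumes "linear_operator S T F"
  shows "g \<in> S \<Longrightarrow> F g \<in> T"
    and "g \<in> S \<Longrightarrow> h \<in> S \<Longrightarrow> F (\<lambda>x. a * g x + b * h x) = (\<lambda>x. a * F g x + b * F h x)"
proof -
  show "F g \<in> T" if "g \<in> S"
    using conjunct1[OF assms[unfolded linear_operator_def]] imageI[OF that] by (rule subsetD)
  show "F (\<lambda>x. a * g x + b * h x) = (\<lambda>x. a * F g x + b * F h x)" if "g \<in> S" "h \<in> S"
    using conjunct2[OF assms[unfolded linear_operator_def], THEN spec, THEN spec, THEN bspec,
        THEN bspec, OF that] .
qed

lemma V_measurable: "g \<in> V D Xs J \<Longrightarrow> g \<in> borel_measurable (feature_space Xs D)"
  unfolding V_def by blast

lemma V_outside: "g \<in> V D Xs J \<Longrightarrow> x \<notin> Pi\<^sub>E D Xs \<Longrightarrow> g x = 0"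
  unfolding V_def mem_Collect_eq by blast

lemma V_depends:
  assumes "g \<in> V D Xs J" "x \<in> Pi\<^sub>E D Xs" "y \<in> Pi\<^sub>E D Xs" "\<And>j. j \<in> J \<Longrightarrow> x j = y j"
  shows "g x = g y"
proof -
  have "\<forall>x\<in>Pi\<^sub>E D Xs. \<forall>y\<in>Pi\<^sub>E D Xs. (\<forall>j\<in>J. x j = y j) \<longrightarrow> g x = g y"
    using assms(1) unfolding V_def mem_Collect_eq by (elim conjE)
  from this[THEN bspec, OF assms(2), THEN bspec, OF assms(3)] show ?thesis
    using assms(4) by (rule mp[OF _ ballI])
qed

text \<open>Extension by zero turns the bound on the image of the domain into a bound at every
  point, so later estimates under an integral need no membership condition.\<close>

lemma V_bounded:
  assumes "g \<in> V D Xs J"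
  obtains B where "\<And>x. \<bar>g x\<bar> \<le> B"
proof -
  have "bounded (g ` Pi\<^sub>E D Xs)"
    using assms unfolding V_def mem_Collect_eq by (elim conjE)
  then obtain B where B: "\<And>x. x \<in> Pi\<^sub>E D Xs \<Longrightarrow> \<bar>g x\<bar> \<le> B"
    unfolding bounded_iff by auto
  have "\<bar>g x\<bar> \<le> max B 0" for x
    by (cases "x \<in> Pi\<^sub>E D Xs") (use B[of x] V_outside[OF assms, of x] in auto)
  then show thesis by (rule that)
qed

lemma V_I:
  assumes "g \<in> borel_measurable (feature_space Xs D)"
    and "\<And>x. x \<in> Pi\<^sub>E D Xs \<Longrightarrow> \<bar>g x\<bar> \<le> B"
    and "\<And>x. x \<notin> Pi\<^sub>E D Xs \<Longrightarrow> g x = 0"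
    and "\<And>x y. x \<in> Pi\<^sub>E D Xs \<Longrightarrow> y \<in> Pi\<^sub>E D Xs \<Longrightarrow> (\<And>j. j \<in> J \<Longrightarrow> x j = y j) \<Longrightarrow> g x = g y"
  shows "g \<in> V D Xs J"
  unfolding V_def mem_Collect_eq
proof (intro conjI ballI allI impI)
  show "bounded (g ` Pi\<^sub>E D Xs)"
    by (rule boundedI[where B = B]) (auto dest: assms(2))
  show "g x = g y"
    if "x \<in> Pi\<^sub>E D Xs" "y \<in> Pi\<^sub>E D Xs" "\<forall>j\<in>J. x j = y j" for x y
    by (rule assms(4)[OF that(1,2)]) (rule bspec[OF that(3)])
qed (fact assms(1), rule assms(3))

lemma V_mono:
  assumes "J \<subseteq> J'"
  shows "V D Xs J \<subseteq> V D Xs J'"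
proof
  fix g assume g: "g \<in> V D Xs J"
  obtain B where B: "\<And>x. \<bar>g x\<bar> \<le> B" using V_bounded[OF g] by blast
  show "g \<in> V D Xs J'"
  proof (rule V_I[where B = B])
    show "g x = g y"
      if "x \<in> Pi\<^sub>E D Xs" "y \<in> Pi\<^sub>E D Xs" "\<And>j. j \<in> J' \<Longrightarrow> x j = y j" for x y
      by (rule V_depends[OF g that(1,2)]) (rule that(3)[OF subsetD[OF assms]])
  qed (use g B in \<open>auto intro: V_measurable V_outside\<close>)
qed

lemma V_zero: "(\<lambda>x. 0) \<in> V D Xs J"
  by (rule V_I[where B = 0]) auto

lemma V_lincomb:
  assumes g: "g \<in> V D Xs J" and h: "h \<in> V D Xs J"
  shows "(\<lambda>x. a * g x + b * h x) \<in> V D Xs J"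
proof -
  obtain B where B: "\<And>x. \<bar>g x\<bar> \<le> B" using V_bounded[OF g] by blast
  obtain C where C: "\<And>x. \<bar>h x\<bar> \<le> C" using V_bounded[OF h] by blast
  note [measurable] = V_measurable[OF g] V_measurable[OF h]
  show ?thesis
  proof (rule V_I[where B = "\<bar>a\<bar> * B + \<bar>b\<bar> * C"])
    fix x
    have "\<bar>a * g x\<bar> \<le> \<bar>a\<bar> * B" "\<bar>b * h x\<bar> \<le> \<bar>b\<bar> * C"
      by (auto simp: abs_mult intro!: mult_left_mono B C)
    then show "\<bar>a * g x + b * h x\<bar> \<le> \<bar>a\<bar> * B + \<bar>b\<bar> * C" by linarith
  next
    fix x y assume *: "x \<in> Pi\<^sub>E D Xs" "y \<in> Pi\<^sub>E D Xs" "\<And>j. j \<in> J \<Longrightarrow> x j = y j"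
    show "a * g x + b * h x = a * g y + b * h y"
      using V_depends[OF g *] V_depends[OF h *] by simp
  qed (use V_outside[OF g] V_outside[OF h] in auto)
qed

lemma V_diff:
  "g \<in> V D Xs J \<Longrightarrow> h \<in> V D Xs J \<Longrightarrow> (\<lambda>x. g x - h x) \<in> V D Xs J"
  using V_lincomb[of g D Xs J h 1 "-1"] by simp

lemma V_sum:
  assumes "finite I" "\<And>i. i \<in> I \<Longrightarrow> f i \<in> V D Xs J"
  shows "(\<lambda>x. \<Sum>i\<in>I. c i * f i x) \<in> V D Xs J"
  using assms
proof (induction I rule: finite_induct)
  case empty
  then show ?case by (simp add: V_zero)
next
  case (insert i I)
  have "(\<lambda>x. c i * f i x + 1 * (\<Sum>i\<in>I. c i * f i x)) \<in> V D Xs J"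
    by (rule V_lincomb) (use insert in auto)
  then show ?case using insert by simp
qed

lemma linear_operator_zero:
  assumes "linear_operator (V D Xs J) T F"
  shows "F (\<lambda>x. 0) = (\<lambda>x. 0)"
  using linear_operatorD(2)[OF assms V_zero V_zero, of 0 0] by simp

lemma linear_operator_diff:
  assumes "linear_operator S T F" "g \<in> S" "h \<in> S"
  shows "F (\<lambda>x. g x - h x) = (\<lambda>x. F g x - F h x)"
  using linear_operatorD(2)[OF assms, of 1 "-1"] by simp

lemma linear_operator_sum:
  assumes F: "linear_operator (V D Xs J) T F"
    and "finite I" "\<And>i. i \<in> I \<Longrightarrow> f i \<in> V D Xs J"
  shows "F (\<lambda>x. \<Sum>i\<in>I. c i * f i x) = (\<lambda>x. \<Sum>i\<in>I. c i * F (f i) x)"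
  using assms(2,3)
proof (induction I rule: finite_induct)
  case empty
  then show ?case by (simp add: linear_operator_zero[OF F])
next
  case (insert i I)
  have "F (\<lambda>x. c i * f i x + 1 * (\<Sum>i\<in>I. c i * f i x))
      = (\<lambda>x. c i * F (f i) x + 1 * F (\<lambda>x. \<Sum>i\<in>I. c i * f i x) x)"
    by (rule linear_operatorD(2)[OF F]) (use insert in \<open>auto intro: V_sum\<close>)
  then show ?case using insert by simp
qed

section \<open>Sums over power sets, substitution and the difference operator\<close>

lemma sum_Pow_insert:
  assumes "finite A" "a \<notin> A"
  shows "(\<Sum>B\<in>Pow (insert a A). f B) = (\<Sum>B\<in>Pow A. f B + f (insert a B))"
proof -
  have "(\<Sum>B\<in>Pow (insert a A). f B) = (\<Sum>B\<in>Pow A. f B) + (\<Sum>B\<in>insert a ` Pow A. f B)"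
    unfolding Pow_insert using assms by (intro sum.union_disjoint) auto
  also have "(\<Sum>B\<in>insert a ` Pow A. f B) = (\<Sum>B\<in>Pow A. f (insert a B))"
  proof (subst sum.reindex)
    show "inj_on (insert a) (Pow A)"
      using assms(2) by (intro inj_onI) (metis PowD insert_ident subsetD)
  qed simp
  finally show ?thesis by (simp add: sum.distrib)
qed

lemma sum_Pow_psubset:
  assumes "finite A"
  shows "(\<Sum>B\<in>Pow A. f B) = (\<Sum>B\<in>{B. B \<subset> A}. f B) + f A"
proof -
  have "Pow A = insert A {B. B \<subset> A}" by auto
  moreover have "finite {B. B \<subset> A}"
    by (rule finite_subset[of _ "Pow A"]) (use assms in auto)
  ultimately show ?thesis by (simp add: add.commute)
qed

text \<open>The cut-off by \<open>on_dom\<close> keeps substituted functions inside the spaces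
  \<open>V\<close>; the summands of \<open>diff_op\<close> carry no such cut-off and agree with
  these on the domain.\<close>

definition subst_op ::
  "nat set \<Rightarrow> (nat \<Rightarrow> real set) \<Rightarrow> (nat \<Rightarrow> real) \<Rightarrow> nat set \<Rightarrow> ((nat \<Rightarrow> real) \<Rightarrow> real) \<Rightarrow> (nat \<Rightarrow> real) \<Rightarrow> real"
  where "subst_op D Xs a J g = on_dom D Xs (\<lambda>x. g (override_on x a J))"

lemma override_on_PiE:
  assumes "x \<in> Pi\<^sub>E D Xs" "J \<subseteq> D" "\<And>j. j \<in> J \<Longrightarrow> a j \<in> Xs j"
  shows "override_on x a J \<in> Pi\<^sub>E D Xs"
  using assms by (auto simp: PiE_def Pi_def extensional_def override_on_def)

lemma measurable_override_on:
  assumes "J \<subseteq> D" "\<And>j. j \<in> J \<Longrightarrow> a j \<in> Xs j"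
  shows "(\<lambda>x. override_on x a J) \<in> feature_space Xs D \<rightarrow>\<^sub>M feature_space Xs D"
proof -
  \<comment> \<open>On extensional points \<open>override_on\<close> is this coordinatewise map,
    whose measurability splits into constants for \<open>j \<in> J\<close> and projections
    otherwise.\<close>
  have "(\<lambda>x. \<lambda>j\<in>D. if j \<in> J then a j else x j) \<in> feature_space Xs D \<rightarrow>\<^sub>M feature_space Xs D"
  proof (rule measurable_restrict)
    fix j assume j: "j \<in> D"
    show "(\<lambda>x. if j \<in> J then a j else x j) \<in> feature_space Xs D \<rightarrow>\<^sub>M restrict_space borel (Xs j)"
    proof (cases "j \<in> J")
      case True
      then show ?thesis using assms by (auto simp: space_restrict_space)
    next
      case False
      then show ?thesis using j by simp
    qed
  qed
  also have "?this \<longleftrightarrow> ?thesis"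
    by (rule measurable_cong)
      (use assms in \<open>auto simp: space_PiM space_restrict_space override_on_def fun_eq_iff PiE_def extensional_def\<close>)
  finally show ?thesis .
qed

text \<open>Points that agree on \<open>K - J\<close> agree on all of \<open>K\<close> once
  \<open>a\<close> has overwritten their coordinates in \<open>J\<close>.\<close>

lemma subst_op_in_V:
  assumes g: "g \<in> V D Xs K" and J: "J \<subseteq> D" "\<And>j. j \<in> J \<Longrightarrow> a j \<in> Xs j"
  shows "subst_op D Xs a J g \<in> V D Xs (K - J)"
proof -
  obtain B where B: "\<And>x. \<bar>g x\<bar> \<le> B" using V_bounded[OF g] by blast
  show ?thesis
  proof (rule V_I[where B = B])
    have "(\<lambda>x. g (override_on x a J)) \<in> borel_measurable (feature_space Xs D)"
      using measurable_compose[OF measurable_override_on[OF J] V_measurable[OF g]] by simp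
    then show "subst_op D Xs a J g \<in> borel_measurable (feature_space Xs D)"
      by (rule measurable_cong[THEN iffD1, rotated])
        (auto simp: subst_op_def on_dom_def space_PiM space_restrict_space)
  next
    fix x y assume xy: "x \<in> Pi\<^sub>E D Xs" "y \<in> Pi\<^sub>E D Xs" "\<And>j. j \<in> K - J \<Longrightarrow> x j = y j"
    have "g (override_on x a J) = g (override_on y a J)"
      by (rule V_depends[OF g]) (use xy J in \<open>auto intro!: override_on_PiE simp: override_on_def\<close>)
    then show "subst_op D Xs a J g x = subst_op D Xs a J g y"
      using xy by (simp add: subst_op_def on_dom_def)
  qed (use B in \<open>auto simp: subst_op_def on_dom_def\<close>)
qed

lemma subst_op_empty: "g \<in> V D Xs K \<Longrightarrow> subst_op D Xs a {} g = g"
  by (auto simp: subst_op_def on_dom_def fun_eq_iff V_outside)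

lemma diff_op_subst_op:
  "x \<in> Pi\<^sub>E D Xs \<Longrightarrow> diff_op J a g x = (\<Sum>J'\<in>Pow J. (- 1) ^ card J' * subst_op D Xs a J' g x)"
  by (simp add: diff_op_def subst_op_def on_dom_def)

text \<open>A coordinate \<open>j\<close> of \<open>J\<close> outside \<open>K\<close> is invisible
  to \<open>g\<close>. Pairing every \<open>B\<close> that avoids \<open>j\<close> with
  \<open>insert j B\<close> gives equal values with opposite signs, so the alternating sum
  cancels.\<close>

lemma partial_zero_V:
  assumes g: "g \<in> V D Xs K" and J: "J \<subseteq> D" "finite J" "\<not> J \<subseteq> K"
  shows "partial_zero D Xs J g"
  unfolding partial_zero_def
proof (intro ballI)
  fix a x assume a: "a \<in> Pi\<^sub>E J Xs" and x: "x \<in> Pi\<^sub>E D Xs"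
  obtain j where j: "j \<in> J" "j \<notin> K" using J by blast
  define L where "L = J - {j}"
  have L: "J = insert j L" "j \<notin> L" "finite L" using j J by (auto simp: L_def)
  have "g (override_on x a (insert j B)) = g (override_on x a B)" if "B \<in> Pow L" for B
  proof (rule V_depends[OF g])
    have B: "B \<subseteq> J" "insert j B \<subseteq> J" using that L by auto
    have "\<And>i. i \<in> J \<Longrightarrow> a i \<in> Xs i" using a by auto
    then show "override_on x a (insert j B) \<in> Pi\<^sub>E D Xs" "override_on x a B \<in> Pi\<^sub>E D Xs"
      using B J(1) x by (meson override_on_PiE order_trans subsetD)+
  next
    fix i assume "i \<in> K"
    with j have "i \<noteq> j" by auto
    then show "override_on x a (insert j B) i = override_on x a B i"
      by (simp add: override_on_def)
  qed
  moreover have "card (insert j B) = Suc (card B)" if "B \<in> Pow L" for B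
    using that L by (subst card_insert_disjoint) (auto intro: finite_subset)
  ultimately have "(\<Sum>B\<in>Pow L. (- 1) ^ card B * g (override_on x a B)
      + (- 1) ^ card (insert j B) * g (override_on x a (insert j B))) = 0"
    by (intro sum.neutral) auto
  then show "diff_op J a g x = 0"
    unfolding diff_op_def L(1) by (simp add: sum_Pow_insert L)
qed

section \<open>Integration against kernels and over independent variables\<close>

text \<open>Integrand and measure both vary with \<open>x\<close>. Pushing \<open>L x\<close>
  forward along \<open>Pair x\<close> moves all dependence into a kernel on the product space and
  leaves one fixed integrand.\<close>

lemma integral_measurable_kernel:
  fixes f :: "'a \<Rightarrow> 'b \<Rightarrow> real"
  assumes f: "(\<lambda>(x, y). f x y) \<in> borel_measurable (M \<Otimes>\<^sub>M N)"
    and L: "L \<in> M \<rightarrow>\<^sub>M subprob_algebra N"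
  shows "(\<lambda>x. \<integral>y. f x y \<partial>L x) \<in> borel_measurable M"
proof -
  have "case_prod Pair \<in> M \<Otimes>\<^sub>M N \<rightarrow>\<^sub>M M \<Otimes>\<^sub>M N"
    by (simp only: case_prod_Pair measurable_ident)
  from measurable_compose[OF measurable_distr2[OF this L] integral_measurable_subprob_algebra[OF f]]
  have "(\<lambda>x. integral\<^sup>L (distr (L x) (M \<Otimes>\<^sub>M N) (Pair x)) (\<lambda>(x, y). f x y)) \<in> borel_measurable M" .
  then show ?thesis
  proof (rule measurable_cong[THEN iffD1, rotated])
    fix x assume x: "x \<in> space M"
    have "Pair x \<in> L x \<rightarrow>\<^sub>M M \<Otimes>\<^sub>M N"
      unfolding measurable_cong_sets[OF sets_kernel[OF L x] refl] by (rule measurable_Pair1'[OF x])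
    from integral_distr[OF this f]
    show "integral\<^sup>L (distr (L x) (M \<Otimes>\<^sub>M N) (Pair x)) (\<lambda>(x, y). f x y) = (\<integral>y. f x y \<partial>L x)"
      by (simp only: prod.case)
  qed
qed

text \<open>By independence the joint law of \<open>Y\<close> and \<open>Z\<close> is the product of
  their laws, and Fubini applies because \<open>\<Phi>\<close> is bounded.\<close>

lemma (in prob_space) indep_var_integral_iterated:
  fixes \<Phi> :: "'b \<times> 'b \<Rightarrow> real"
  assumes indep: "indep_var S Y T Z"
    and \<Phi>: "\<Phi> \<in> borel_measurable (S \<Otimes>\<^sub>M T)" and B: "\<And>z. \<bar>\<Phi> z\<bar> \<le> B"
  shows "(\<integral>\<omega>. \<integral>\<omega>'. \<Phi> (Y \<omega>, Z \<omega>') \<partial>M \<partial>M) = (\<integral>\<omega>. \<Phi> (Y \<omega>, Z \<omega>) \<partial>M)"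
proof -
  have Y: "random_variable S Y" and Z: "random_variable T Z"
    and eq: "distr M S Y \<Otimes>\<^sub>M distr M T Z = distr M (S \<Otimes>\<^sub>M T) (\<lambda>\<omega>. (Y \<omega>, Z \<omega>))"
    using indep[unfolded indep_var_distribution_eq] by blast+
  interpret PY: prob_space "distr M S Y" by (rule prob_space_distr[OF Y])
  interpret PZ: prob_space "distr M T Z" by (rule prob_space_distr[OF Z])
  interpret P: pair_prob_space "distr M S Y" "distr M T Z" ..
  have slice: "(\<lambda>v. \<Phi> (u, v)) \<in> borel_measurable T" if "u \<in> space S" for u
    by (rule measurable_compose[OF measurable_Pair1'[OF that] \<Phi>])
  have "(\<lambda>(u, v). \<Phi> (u, v)) \<in> borel_measurable (S \<Otimes>\<^sub>M distr M T Z)"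
    unfolding measurable_cong_sets[OF sets_pair_measure_cong[OF refl sets_distr] refl]
    by (simp only: case_prod_eta \<Phi>)
  then have inner: "(\<lambda>u. \<integral>v. \<Phi> (u, v) \<partial>distr M T Z) \<in> borel_measurable S"
    by (rule PZ.borel_measurable_lebesgue_integral)
  have "(\<integral>\<omega>. \<Phi> (Y \<omega>, Z \<omega>) \<partial>M) = integral\<^sup>L (distr M S Y \<Otimes>\<^sub>M distr M T Z) \<Phi>"
    unfolding eq by (rule integral_distr[OF measurable_Pair[OF Y Z] \<Phi>, symmetric])
  also have "\<dots> = (\<integral>u. \<integral>v. \<Phi> (u, v) \<partial>distr M T Z \<partial>distr M S Y)"
  proof (rule P.integral_fst'[symmetric])
    have "\<Phi> \<in> borel_measurable (distr M S Y \<Otimes>\<^sub>M distr M T Z)"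
      unfolding measurable_cong_sets[OF sets_pair_measure_cong[OF sets_distr sets_distr] refl]
      by (rule \<Phi>)
    then show "integrable (distr M S Y \<Otimes>\<^sub>M distr M T Z) \<Phi>"
      by (rule P.integrable_const_bound[where B = B, rotated]) (simp add: B)
  qed
  also have "\<dots> = (\<integral>\<omega>. \<integral>v. \<Phi> (Y \<omega>, v) \<partial>distr M T Z \<partial>M)"
    by (rule integral_distr[OF Y inner])
  also have "\<dots> = (\<integral>\<omega>. \<integral>\<omega>'. \<Phi> (Y \<omega>, Z \<omega>') \<partial>M \<partial>M)"
  proof (rule Bochner_Integration.integral_cong[OF refl])
    fix \<omega> assume "\<omega> \<in> space M"
    then show "(\<integral>v. \<Phi> (Y \<omega>, v) \<partial>distr M T Z) = (\<integral>\<omega>'. \<Phi> (Y \<omega>, Z \<omega>') \<partial>M)"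
      by (intro integral_distr[OF Z] slice measurable_space[OF Y])
  qed
  finally show ?thesis by (rule sym)
qed

section \<open>The setting and the conditional average \<open>C\<close>\<close>

locale ce_setting = prob_space M
  for M :: "'w measure" +
  fixes D :: "nat set"
    and Xs :: "nat \<Rightarrow> real set"
    and X :: "nat \<Rightarrow> 'w \<Rightarrow> real"
    and \<kappa> :: "nat set \<Rightarrow> (nat \<Rightarrow> real) \<Rightarrow> (nat \<Rightarrow> real) measure"
    and r :: "nat \<Rightarrow> real"
  assumes finite_D: "finite D"
    and X_measurable: "\<And>j. j \<in> D \<Longrightarrow> X j \<in> borel_measurable M"
    and X_range: "\<And>j \<omega>. j \<in> D \<Longrightarrow> \<omega> \<in> space M \<Longrightarrow> X j \<omega> \<in> Xs j"
    and \<kappa>_kernel: "\<And>J. J \<subseteq> D \<Longrightarrow> \<kappa> J \<in> feature_space Xs J \<rightarrow>\<^sub>M prob_algebra (feature_space Xs (D - J))"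
    and \<kappa>_indep: "\<And>J x. indep_vars (\<lambda>_. borel) X D \<Longrightarrow> J \<subseteq> D \<Longrightarrow> x \<in> Pi\<^sub>E J Xs
           \<Longrightarrow> \<kappa> J x = distr M (feature_space Xs (D - J)) (feature_vec X (D - J))"
    and r_range: "\<And>j. j \<in> D \<Longrightarrow> r j \<in> Xs j"
begin

abbreviation "FS \<equiv> feature_space Xs"
abbreviation "VV \<equiv> V D Xs"
abbreviation "L \<equiv> L_CE D Xs \<kappa> r"
abbreviation "H \<equiv> H_CE M D Xs X \<kappa> r"
abbreviation "S \<equiv> subst_op D Xs r"

definition C :: "nat set \<Rightarrow> ((nat \<Rightarrow> real) \<Rightarrow> real) \<Rightarrow> (nat \<Rightarrow> real) \<Rightarrow> real" where
  "C J g = on_dom D Xs (\<lambda>x. \<integral>y. g (merge J (D - J) (x, y)) \<partial>\<kappa> J (restrict x J))"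

lemma finite_subset_D: "J \<subseteq> D \<Longrightarrow> finite J"
  using finite_D by (rule rev_finite_subset)

lemma space_FS: "space (FS J) = Pi\<^sub>E J Xs"
  by (simp add: space_PiM space_restrict_space)

lemma feature_vec_measurable: "J \<subseteq> D \<Longrightarrow> feature_vec X J \<in> M \<rightarrow>\<^sub>M FS J"
  by (intro measurable_restrict measurable_restrict_space2) (simp_all add: X_range X_measurable subset_iff Pi_iff)

lemma feature_vec_PiE: "J \<subseteq> D \<Longrightarrow> \<omega> \<in> space M \<Longrightarrow> feature_vec X J \<omega> \<in> Pi\<^sub>E J Xs"
  by (auto simp: X_range subset_iff)

lemma merge_PiE:
  assumes "J \<subseteq> D" "x \<in> Pi J Xs" "y \<in> Pi\<^sub>E (D - J) Xs"
  shows "merge J (D - J) (x, y) \<in> Pi\<^sub>E D Xs"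
proof -
  have "J \<union> (D - J) = D" using assms by auto
  then show ?thesis using PiE_cancel_merge[of J "D - J" x y Xs] assms by (auto simp: PiE_def)
qed

lemma merge_measurable:
  assumes "J \<subseteq> D"
  shows "merge J (D - J) \<in> FS J \<Otimes>\<^sub>M FS (D - J) \<rightarrow>\<^sub>M FS D"
proof -
  have "J \<union> (D - J) = D" using assms by auto
  then show ?thesis using measurable_merge[of J "D - J" "\<lambda>j. restrict_space borel (Xs j)"] by simp
qed

lemma \<kappa>_prob:
  assumes "J \<subseteq> D" "x \<in> Pi\<^sub>E J Xs"
  shows "prob_space (\<kappa> J x)" "sets (\<kappa> J x) = sets (FS (D - J))" "space (\<kappa> J x) = Pi\<^sub>E (D - J) Xs"
proof -
  have "\<kappa> J x \<in> space (prob_algebra (FS (D - J)))"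
    using measurable_space[OF \<kappa>_kernel[OF assms(1)], of x] assms(2) by (simp add: space_FS)
  then show "prob_space (\<kappa> J x)" "sets (\<kappa> J x) = sets (FS (D - J))"
    by (auto simp: space_prob_algebra)
  then show "space (\<kappa> J x) = Pi\<^sub>E (D - J) Xs"
    by (metis sets_eq_imp_space_eq space_FS)
qed

lemma merge_section_measurable:
  assumes "J \<subseteq> D" "x \<in> Pi\<^sub>E D Xs" "g \<in> VV K"
  shows "(\<lambda>y. g (merge J (D - J) (x, y))) \<in> borel_measurable (FS (D - J))"
proof -
  have "(\<lambda>y. merge J (D - J) (restrict x J, y)) \<in> FS (D - J) \<rightarrow>\<^sub>M FS D"
    by (rule measurable_compose[OF measurable_Pair1' merge_measurable])
      (use assms in \<open>auto simp: space_FS\<close>)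
  then show ?thesis
    using measurable_compose[OF _ V_measurable[OF assms(3)]] by simp
qed

lemma merge_section_integrable:
  assumes "J \<subseteq> D" "x \<in> Pi\<^sub>E D Xs" "g \<in> VV K"
    and "prob_space N" "sets N = sets (FS (D - J))"
  shows "integrable N (\<lambda>y. g (merge J (D - J) (x, y)))"
proof -
  interpret N: prob_space N by fact
  obtain B where B: "\<And>x. \<bar>g x\<bar> \<le> B" using V_bounded[OF assms(3)] by blast
  have "(\<lambda>y. g (merge J (D - J) (x, y))) \<in> borel_measurable N"
    using merge_section_measurable[OF assms(1-3)] measurable_cong_sets[OF assms(5) refl] by blast
  then show ?thesis
    by (intro N.integrable_const_bound[where B = B]) (auto simp: B)
qed

lemma restrict_PiE_subset: "J \<subseteq> D \<Longrightarrow> x \<in> Pi\<^sub>E D Xs \<Longrightarrow> restrict x J \<in> Pi\<^sub>E J Xs"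
  by (auto simp: PiE_mem subset_iff)

lemma C_integrable:
  assumes "J \<subseteq> D" "x \<in> Pi\<^sub>E D Xs" "g \<in> VV K"
  shows "integrable (\<kappa> J (restrict x J)) (\<lambda>y. g (merge J (D - J) (x, y)))"
  by (rule merge_section_integrable[OF assms \<kappa>_prob(1,2)]) (use assms in auto)

lemma C_in_V:
  assumes J: "J \<subseteq> D" and g: "g \<in> VV K"
  shows "C J g \<in> VV J"
proof -
  obtain B where B: "\<And>x. \<bar>g x\<bar> \<le> B" using V_bounded[OF g] by blast
  show ?thesis
  proof (rule V_I[where B = B])
    \<comment> \<open>The kernel is measurable on the points over \<open>J\<close>, so measurability
      is shown there and then pulled back along the restriction from \<open>D\<close> to
      \<open>J\<close>.\<close>
    have "(\<lambda>x. \<integral>y. g (merge J (D - J) (x, y)) \<partial>\<kappa> J x) \<in> borel_measurable (FS J)"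
    proof (rule integral_measurable_kernel)
      show "(\<lambda>(x, y). g (merge J (D - J) (x, y))) \<in> borel_measurable (FS J \<Otimes>\<^sub>M FS (D - J))"
        using measurable_compose[OF merge_measurable[OF J] V_measurable[OF g]]
        by (simp add: split_def)
    qed (use \<kappa>_kernel[OF J] in \<open>rule measurable_prob_algebraD\<close>)
    from measurable_compose[OF measurable_restrict_subset[OF J] this]
    have "(\<lambda>x. \<integral>y. g (merge J (D - J) (x, y)) \<partial>\<kappa> J (restrict x J)) \<in> borel_measurable (FS D)"
      by simp
    then show "C J g \<in> borel_measurable (FS D)"
      by (rule measurable_cong[THEN iffD1, rotated]) (auto simp: C_def on_dom_def space_FS)
  next
    fix x assume x: "x \<in> Pi\<^sub>E D Xs"
    interpret N: prob_space "\<kappa> J (restrict x J)"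
      using \<kappa>_prob(1)[OF J restrict_PiE_subset[OF J x]] .
    have "\<bar>\<integral>y. g (merge J (D - J) (x, y)) \<partial>\<kappa> J (restrict x J)\<bar>
        \<le> (\<integral>y. \<bar>g (merge J (D - J) (x, y))\<bar> \<partial>\<kappa> J (restrict x J))"
      by (rule integral_abs_bound)
    also have "\<dots> \<le> B"
      using C_integrable[OF J x g] by (intro N.integral_le_const) (auto simp: B)
    finally show "\<bar>C J g x\<bar> \<le> B" using x by (simp add: C_def on_dom_def)
  next
    fix x y assume *: "x \<in> Pi\<^sub>E D Xs" "y \<in> Pi\<^sub>E D Xs" "\<And>j. j \<in> J \<Longrightarrow> x j = y j"
    then have "restrict x J = restrict y J" by (auto simp: restrict_def)
    moreover from this have "merge J (D - J) (x, z) = merge J (D - J) (y, z)" for z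
      by (metis merge_restrict(1))
    ultimately show "C J g x = C J g y" using * by (simp add: C_def on_dom_def)
  qed (auto simp: C_def on_dom_def)
qed

lemma C_linear:
  assumes J: "J \<subseteq> D"
  shows "linear_operator (VV D) (VV J) (C J)"
  unfolding linear_operator_def
proof (intro conjI allI ballI)
  show "C J ` VV D \<subseteq> VV J" using C_in_V[OF J] by auto
next
  fix a b g h assume g: "g \<in> VV D" and h: "h \<in> VV D"
  show "C J (\<lambda>x. a * g x + b * h x) = (\<lambda>x. a * C J g x + b * C J h x)"
  proof
    fix x
    show "C J (\<lambda>x. a * g x + b * h x) x = a * C J g x + b * C J h x"
      using C_integrable[OF J _ g, of x] C_integrable[OF J _ h, of x]
      by (simp add: C_def on_dom_def)
  qed
qed

text \<open>\<open>\<kappa> J\<close> has total mass one, and merging leaves the coordinates in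
  \<open>J\<close> untouched, so the integrand is the constant \<open>g x\<close>.\<close>

lemma C_fixes_V:
  assumes J: "J \<subseteq> D" and g: "g \<in> VV J"
  shows "C J g = g"
proof
  fix x
  show "C J g x = g x"
  proof (cases "x \<in> Pi\<^sub>E D Xs")
    case True
    interpret N: prob_space "\<kappa> J (restrict x J)"
      using \<kappa>_prob(1)[OF J restrict_PiE_subset[OF J True]] .
    have "(\<integral>y. g (merge J (D - J) (x, y)) \<partial>\<kappa> J (restrict x J)) = (\<integral>y. g x \<partial>\<kappa> J (restrict x J))"
    proof (rule Bochner_Integration.integral_cong[OF refl])
      fix y assume "y \<in> space (\<kappa> J (restrict x J))"
      then have y: "y \<in> Pi\<^sub>E (D - J) Xs"
        using \<kappa>_prob(3)[OF J restrict_PiE_subset[OF J True]] by simp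
      show "g (merge J (D - J) (x, y)) = g x"
        by (rule V_depends[OF g]) (use True y J in \<open>auto intro!: merge_PiE simp: merge_def\<close>)
    qed
    then show ?thesis using True by (simp add: C_def on_dom_def N.prob_space)
  next
    case False
    then show ?thesis using V_outside[OF g] by (simp add: C_def on_dom_def)
  qed
qed

section \<open>Substitution of representatives and the operator \<open>L\<close>\<close>

lemma S_in_V: "J \<subseteq> D \<Longrightarrow> g \<in> VV K \<Longrightarrow> S J g \<in> VV (K - J)"
  by (rule subst_op_in_V) (use r_range in auto)

lemma VV_D: "J \<subseteq> D \<Longrightarrow> g \<in> VV J \<Longrightarrow> g \<in> VV D"
  using V_mono by blast

lemma S_in_VD: "J \<subseteq> D \<Longrightarrow> g \<in> VV D \<Longrightarrow> S J g \<in> VV D"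
  by (rule VV_D[OF _ S_in_V]) auto

text \<open>Linearity of \<open>C J\<close> carries the average through the alternating sum. The
  summand for \<open>J' = {}\<close> is \<open>C J g\<close>; all others involve a
  substitution.\<close>

lemma L_expand:
  assumes J: "J \<subseteq> D" and g: "g \<in> VV D"
  shows "L J g = (\<lambda>x. \<Sum>J'\<in>Pow J. (- 1) ^ card J' * C J (S J' g) x)"
proof -
  define G where "G = (\<lambda>x. \<Sum>J'\<in>Pow J. (- 1) ^ card J' * S J' g x)"
  have fin: "finite (Pow J)" using finite_subset_D[OF J] by simp
  have "L J g x = C J G x" for x
  proof (cases "x \<in> Pi\<^sub>E D Xs")
    case x: True
    have "(\<integral>y. diff_op J (restrict r J) g (merge J (D - J) (x, y)) \<partial>\<kappa> J (restrict x J))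
        = (\<integral>y. G (merge J (D - J) (x, y)) \<partial>\<kappa> J (restrict x J))"
    proof (rule Bochner_Integration.integral_cong[OF refl])
      fix y assume "y \<in> space (\<kappa> J (restrict x J))"
      then have y: "y \<in> Pi\<^sub>E (D - J) Xs"
        using \<kappa>_prob(3)[OF J restrict_PiE_subset[OF J x]] by simp
      have z: "merge J (D - J) (x, y) \<in> Pi\<^sub>E D Xs"
        by (rule merge_PiE) (use x y J in auto)
      \<comment> \<open>Substituting on a subset of \<open>J\<close> reads the base point only
        inside \<open>J\<close>, so \<open>restrict r J\<close> may be replaced by
        \<open>r\<close>.\<close>
      have "override_on z (restrict r J) J' = override_on z r J'" if "J' \<in> Pow J" for z J'
        using that by (auto simp: override_on_def fun_eq_iff)
      then have "diff_op J (restrict r J) g (merge J (D - J) (x, y))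
          = diff_op J r g (merge J (D - J) (x, y))"
        by (simp add: diff_op_def)
      also note diff_op_subst_op[OF z]
      finally show "diff_op J (restrict r J) g (merge J (D - J) (x, y)) = G (merge J (D - J) (x, y))"
        unfolding G_def .
    qed
    then show ?thesis using x by (simp add: C_def L_CE_def on_dom_def)
  qed (simp add: C_def L_CE_def on_dom_def)
  moreover have "C J G = (\<lambda>x. \<Sum>J'\<in>Pow J. (- 1) ^ card J' * C J (S J' g) x)"
    unfolding G_def
    by (rule linear_operator_sum[OF C_linear[OF J] fin]) (use J g S_in_VD in auto)
  ultimately show ?thesis by auto
qed

lemma S_linear:
  assumes "J \<subseteq> D"
  shows "linear_operator (VV D) (VV D) (S J)"
  unfolding linear_operator_def using S_in_VD[OF assms]
  by (auto simp: subst_op_def on_dom_def fun_eq_iff)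

lemma L_in_V:
  assumes J: "J \<subseteq> D" and g: "g \<in> VV D"
  shows "L J g \<in> VV J"
  unfolding L_expand[OF assms]
proof (rule V_sum)
  show "finite (Pow J)" using finite_subset_D[OF J] by simp
  show "C J (S J' g) \<in> VV J" if "J' \<in> Pow J" for J'
    by (rule C_in_V[OF J S_in_VD[OF _ g]]) (use that J in auto)
qed

lemma L_linear:
  assumes J: "J \<subseteq> D"
  shows "linear_operator (VV D) (VV J) (L J)"
  unfolding linear_operator_def
proof (intro conjI allI ballI)
  show "L J ` VV D \<subseteq> VV J" using L_in_V[OF J] by auto
next
  fix a b g h assume g: "g \<in> VV D" and h: "h \<in> VV D"
  have "C J (S J' (\<lambda>x. a * g x + b * h x)) x = a * C J (S J' g) x + b * C J (S J' h) x"
    if "J' \<in> Pow J" for J' x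
  proof -
    have "J' \<subseteq> D" using that J by auto
    then show ?thesis
      by (simp add: linear_operatorD(2)[OF S_linear g h] linear_operatorD(2)[OF C_linear[OF J]]
          S_in_VD g h)
  qed
  then show "L J (\<lambda>x. a * g x + b * h x) = (\<lambda>x. a * L J g x + b * L J h x)"
    by (simp add: L_expand J g h V_lincomb fun_eq_iff sum_distrib_left sum.distrib[symmetric]
        algebra_simps)
qed

text \<open>The representative values form one admissible base point, and merged points stay in the
  domain, so the integrand is zero throughout.\<close>

lemma L_partial_zero:
  assumes J: "J \<subseteq> D" and g: "partial_zero D Xs J g"
  shows "L J g = (\<lambda>x. 0)"
proof
  fix x
  show "L J g x = 0"
  proof (cases "x \<in> Pi\<^sub>E D Xs")
    case x: True
    have "(\<integral>y. diff_op J (restrict r J) g (merge J (D - J) (x, y)) \<partial>\<kappa> J (restrict x J))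
        = (\<integral>y. 0 \<partial>\<kappa> J (restrict x J))"
    proof (rule Bochner_Integration.integral_cong[OF refl])
      fix y assume "y \<in> space (\<kappa> J (restrict x J))"
      then have y: "y \<in> Pi\<^sub>E (D - J) Xs"
        using \<kappa>_prob(3)[OF J restrict_PiE_subset[OF J x]] by simp
      have z: "merge J (D - J) (x, y) \<in> Pi\<^sub>E D Xs"
        by (rule merge_PiE) (use x y J in auto)
      moreover have "restrict r J \<in> Pi\<^sub>E J Xs" using r_range J by auto
      ultimately show "diff_op J (restrict r J) g (merge J (D - J) (x, y)) = 0"
        using g unfolding partial_zero_def by blast
    qed
    then show ?thesis using x by (simp add: L_CE_def on_dom_def)
  qed (simp add: L_CE_def on_dom_def)
qed

section \<open>The recursion for \<open>H\<close> and the unconditional average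
  \<open>E\<close>\<close>

definition R :: "nat set \<Rightarrow> ((nat \<Rightarrow> real) \<Rightarrow> real) \<Rightarrow> (nat \<Rightarrow> real) \<Rightarrow> real" where
  "R J f = (\<lambda>x. f x - (\<Sum>J'\<in>{J'. J' \<subset> J}. H J' f x))"

lemma H_empty: "H {} g = expect M D Xs X g"
  by (subst H_CE.simps) simp

lemma H_R:
  assumes "J \<subseteq> D" "J \<noteq> {}"
  shows "H J g = R J (L J g)"
  unfolding R_def using assms finite_subset_D by (subst H_CE.simps) simp

lemma finite_psubsets: "J \<subseteq> D \<Longrightarrow> finite {J'. J' \<subset> J}"
  by (rule finite_subset[of _ "Pow D"]) (use finite_D in auto)

abbreviation "E \<equiv> expect_out M D Xs X"

text \<open>A constant kernel; taking \<open>x\<close> as an argument gives it the type of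
  \<open>\<kappa>\<close>.\<close>

definition marginal :: "nat set \<Rightarrow> (nat \<Rightarrow> real) \<Rightarrow> (nat \<Rightarrow> real) measure" where
  "marginal J x = distr M (FS (D - J)) (feature_vec X (D - J))"

lemma marginal_ce_setting: "ce_setting M D Xs X marginal r"
proof
  show "marginal J \<in> FS J \<rightarrow>\<^sub>M prob_algebra (FS (D - J))" if "J \<subseteq> D" for J
    unfolding marginal_def[abs_def]
    by (rule measurable_const)
      (auto simp: space_prob_algebra intro!: prob_space_distr feature_vec_measurable)
qed (auto simp: marginal_def finite_D X_measurable X_range r_range)

text \<open>Unconditional averaging is the instance of \<open>C\<close> for the constant kernel \<open>marginal\<close>, so the
  general facts about \<open>C\<close> apply to it.\<close>

interpretation P: ce_setting M D Xs X marginal r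
  by (rule marginal_ce_setting)

lemma E_eq_P:
  assumes J: "J \<subseteq> D" and g: "g \<in> VV D"
  shows "E J g = P.C J g"
proof
  fix x
  show "E J g x = P.C J g x"
  proof (cases "x \<in> Pi\<^sub>E D Xs")
    case x: True
    show ?thesis
      using x unfolding expect_out_def P.C_def on_dom_def marginal_def
      by (simp add: integral_distr[OF feature_vec_measurable merge_section_measurable[OF J x g]])
  qed (simp add: expect_out_def P.C_def on_dom_def)
qed

lemma E_in_V: "J \<subseteq> D \<Longrightarrow> g \<in> VV D \<Longrightarrow> E J g \<in> VV J"
  using P.C_in_V E_eq_P by simp

lemma E_empty: "E {} g = expect M D Xs X g"
proof -
  have "merge {} D (x, feature_vec X D \<omega>) = feature_vec X D \<omega>" for x \<omega>
    by (auto simp: merge_def fun_eq_iff)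
  then show ?thesis by (simp add: expect_out_def expect_def)
qed

text \<open>Expectation is the unconditional average that keeps no variable, so the base of the
  recursion inherits the properties of \<open>C\<close>.\<close>

lemma H_empty_eq: "g \<in> VV D \<Longrightarrow> H {} g = P.C {} g"
  using E_eq_P[of "{}"] by (simp add: H_empty E_empty)

section \<open>Linearity and relevance of \<open>H\<close>\<close>

lemma H_empty_linear: "linear_operator (VV D) (VV {}) (H {})"
  unfolding linear_operator_def
proof (intro conjI allI ballI)
  show "H {} ` VV D \<subseteq> VV {}" using P.C_in_V[of "{}"] by (auto simp: H_empty_eq)
next
  fix a b g h assume g: "g \<in> VV D" and h: "h \<in> VV D"
  then show "H {} (\<lambda>x. a * g x + b * h x) = (\<lambda>x. a * H {} g x + b * H {} h x)"
    using linear_operatorD(2)[OF P.C_linear[of "{}"] g h]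
    by (simp add: H_empty_eq[OF V_lincomb[OF g h]] H_empty_eq[OF g] H_empty_eq[OF h])
qed

text \<open>Linearity of the smaller \<open>H K\<close> is a hypothesis because linearity of
  \<open>R J\<close> is needed inside the induction that proves it for \<open>H\<close>.\<close>

lemma R_linear_aux:
  assumes J: "J \<subseteq> D" and H: "\<And>K. K \<subset> J \<Longrightarrow> linear_operator (VV D) (VV K) (H K)"
  shows "linear_operator (VV D) (VV D) (R J)"
    and "f \<in> VV J \<Longrightarrow> R J f \<in> VV J"
proof -
  \<comment> \<open>Letting \<open>I\<close> range between \<open>J\<close> and \<open>D\<close>
    serves both claims: \<open>I = D\<close> for linearity, \<open>I = J\<close> for the range on
    \<open>VV J\<close>.\<close>
  have *: "R J f \<in> VV I" if f: "f \<in> VV I" and I: "J \<subseteq> I" "I \<subseteq> D" for f I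
  proof -
    have "(\<lambda>x. \<Sum>K\<in>{K. K \<subset> J}. 1 * H K f x) \<in> VV I"
    proof (rule V_sum[OF finite_psubsets[OF J]])
      fix K assume "K \<in> {K. K \<subset> J}"
      then have "H K f \<in> VV K" "K \<subseteq> I"
        using linear_operatorD(1)[OF H VV_D[OF I(2) f]] I by auto
      then show "H K f \<in> VV I" using V_mono by blast
    qed
    from V_diff[OF f this] show ?thesis by (simp add: R_def)
  qed
  show "f \<in> VV J \<Longrightarrow> R J f \<in> VV J" using * J by auto
  show "linear_operator (VV D) (VV D) (R J)"
    unfolding linear_operator_def
  proof (intro conjI allI ballI)
    show "R J ` VV D \<subseteq> VV D" using * J by auto
  next
    fix a b g h assume g: "g \<in> VV D" and h: "h \<in> VV D"
    have "(\<Sum>K\<in>{K. K \<subset> J}. H K (\<lambda>x. a * g x + b * h x) x)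
        = (\<Sum>K\<in>{K. K \<subset> J}. a * H K g x + b * H K h x)" for x
    proof (rule sum.cong[OF refl])
      fix K assume "K \<in> {K. K \<subset> J}"
      then have "linear_operator (VV D) (VV K) (H K)" using H by simp
      from linear_operatorD(2)[OF this g h]
      show "H K (\<lambda>x. a * g x + b * h x) x = a * H K g x + b * H K h x" by (rule fun_cong)
    qed
    then show "R J (\<lambda>x. a * g x + b * h x) = (\<lambda>x. a * R J g x + b * R J h x)"
      unfolding R_def by (simp add: sum.distrib sum_distrib_left algebra_simps)
  qed
qed

lemma H_linear: "J \<subseteq> D \<Longrightarrow> linear_operator (VV D) (VV J) (H J)"
proof (induction "card J" arbitrary: J rule: less_induct)
  case less
  show ?case
  proof (cases "J = {}")
    case True
    then show ?thesis using H_empty_linear by simp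
  next
    case False
    have IH: "linear_operator (VV D) (VV K) (H K)" if "K \<subset> J" for K
      using less that psubset_card_mono[OF finite_subset_D[OF less.prems] that] by auto
    note R = R_linear_aux[OF less.prems IH]
    note LJ = linear_operatorD[OF L_linear[OF less.prems]]
    show ?thesis
      unfolding linear_operator_def
    proof (intro conjI allI ballI)
      show "H J ` VV D \<subseteq> VV J"
        using R(2) LJ(1) by (auto simp: H_R[OF less.prems False])
    next
      fix a b g h assume g: "g \<in> VV D" and h: "h \<in> VV D"
      have "L J g \<in> VV D" "L J h \<in> VV D" using LJ(1) g h VV_D[OF less.prems] by auto
      from linear_operatorD(2)[OF R(1) this]
      show "H J (\<lambda>x. a * g x + b * h x) = (\<lambda>x. a * H J g x + b * H J h x)"
        by (simp add: H_R[OF less.prems False] LJ(2)[OF g h])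
    qed
  qed
qed

lemma H_in_V: "J \<subseteq> D \<Longrightarrow> g \<in> VV D \<Longrightarrow> H J g \<in> VV J"
  by (rule linear_operatorD(1)[OF H_linear])

lemma H_in_VD: "J \<subseteq> D \<Longrightarrow> g \<in> VV D \<Longrightarrow> H J g \<in> VV D"
  by (rule VV_D[OF _ H_in_V])

lemma R_linear: "J \<subseteq> D \<Longrightarrow> linear_operator (VV D) (VV D) (R J)"
  by (rule R_linear_aux(1)) (assumption, meson H_linear order_trans psubset_imp_subset)

text \<open>For nonempty \<open>J\<close> the operator \<open>L J\<close> already sends
  \<open>g\<close> to zero, and \<open>R J\<close> is linear. For empty \<open>J\<close> the
  difference has the single term \<open>g\<close>, so the hypothesis forces \<open>g\<close> itself
  to vanish.\<close>

lemma H_relevance: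
  assumes J: "J \<subseteq> D" and g: "g \<in> VV D" and z: "partial_zero D Xs J g"
  shows "H J g = (\<lambda>x. 0)"
proof (cases "J = {}")
  case True
  have "g x = 0" for x
  proof (cases "x \<in> Pi\<^sub>E D Xs")
    case x: True
    \<comment> \<open>The empty product has exactly this one point, which serves as the base
      point.\<close>
    have "diff_op {} (\<lambda>x. undefined) g x = 0"
      using z x unfolding partial_zero_def True by auto
    then show ?thesis by (simp add: diff_op_def)
  qed (use V_outside[OF g] in auto)
  then have "g = (\<lambda>x. 0)" by auto
  then show ?thesis using linear_operator_zero[OF H_linear[OF J]] by simp
next
  case False
  then show ?thesis
    using linear_operator_zero[OF R_linear[OF J]] by (simp add: H_R[OF J] L_partial_zero[OF J z])
qed

lemma H_vanishes:
  assumes "J \<subseteq> D" "K \<subseteq> D" "\<not> J \<subseteq> K" "g \<in> VV K"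
  shows "H J g = (\<lambda>x. 0)"
  using assms by (intro H_relevance partial_zero_V VV_D finite_subset_D)

definition decomposes :: "nat set \<Rightarrow> bool" where
  "decomposes J \<longleftrightarrow> (\<forall>g\<in>VV J. (\<lambda>x. \<Sum>J'\<in>Pow J. H J' g x) = g)"

lemma decomposesD: "decomposes J \<Longrightarrow> g \<in> VV J \<Longrightarrow> (\<Sum>J'\<in>Pow J. H J' g x) = g x"
  unfolding decomposes_def by (drule (1) bspec) (drule fun_cong)

text \<open>Relevance removes every \<open>H J' f\<close> with \<open>J'\<close> not inside
  \<open>K\<close>. All subsets of \<open>K\<close> occur in the sum of \<open>R J\<close> because
  \<open>K\<close> is a proper subset of \<open>J\<close>, and by decomposability at
  \<open>K\<close> they add up to \<open>f\<close>.\<close>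

lemma R_annihilates:
  assumes J: "J \<subseteq> D" and K: "K \<subset> J" "decomposes K" and f: "f \<in> VV K"
  shows "R J f = (\<lambda>x. 0)"
proof
  fix x
  have "(\<Sum>J'\<in>{J'. J' \<subset> J}. H J' f x) = (\<Sum>J'\<in>Pow K. H J' f x)"
  proof (rule sum.mono_neutral_right[OF finite_psubsets[OF J]])
    show "Pow K \<subseteq> {J'. J' \<subset> J}" using K by auto
    show "\<forall>J'\<in>{J'. J' \<subset> J} - Pow K. H J' f x = 0"
    proof
      fix J' assume "J' \<in> {J'. J' \<subset> J} - Pow K"
      then have "H J' f = (\<lambda>x. 0)" using J K f by (intro H_vanishes[where K = K]) auto
      then show "H J' f x = 0" by simp
    qed
  qed
  then show "R J f x = 0" by (simp add: R_def decomposesD[OF K(2) f])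
qed

text \<open>All terms of \<open>L J g\<close> other than \<open>C J g\<close> live on proper subsets of \<open>J\<close>, where \<open>R J\<close> is zero.\<close>

lemma H_eq_R_C:
  assumes J: "J \<subseteq> D" "J \<noteq> {}" and IH: "\<And>K. K \<subset> J \<Longrightarrow> decomposes K" and g: "g \<in> VV D"
    and S: "\<And>J'. J' \<subseteq> J \<Longrightarrow> C J (S J' g) \<in> VV (J - J')"
  shows "H J g = R J (C J g)"
proof -
  have fin: "finite (Pow J)" using finite_subset_D[OF J(1)] by simp
  have "H J g = (\<lambda>x. \<Sum>J'\<in>Pow J. (- 1) ^ card J' * R J (C J (S J' g)) x)"
    unfolding H_R[OF J] L_expand[OF J(1) g]
  proof (rule linear_operator_sum[OF R_linear[OF J(1)] fin])
    fix J' assume J': "J' \<in> Pow J"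
    show "C J (S J' g) \<in> VV D"
      by (rule VV_D[OF _ S]) (use J J' in auto)
  qed
  also have "\<dots> = (\<lambda>x. \<Sum>J'\<in>{{}}. (- 1) ^ card J' * R J (C J (S J' g)) x)"
  proof
    fix x
    show "(\<Sum>J'\<in>Pow J. (- 1) ^ card J' * R J (C J (S J' g)) x)
        = (\<Sum>J'\<in>{{}}. (- 1) ^ card J' * R J (C J (S J' g)) x)"
    proof (rule sum.mono_neutral_right[OF fin])
      show "\<forall>J'\<in>Pow J - {{}}. (- 1) ^ card J' * R J (C J (S J' g)) x = 0"
      proof
        fix J' assume J': "J' \<in> Pow J - {{}}"
        then have "J - J' \<subset> J" by auto
        from R_annihilates[OF J(1) this IH[OF this] S]
        have "R J (C J (S J' g)) = (\<lambda>x. 0)" using J' by auto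
        then show "(- 1) ^ card J' * R J (C J (S J' g)) x = 0" by simp
      qed
    qed auto
  qed
  finally show ?thesis by (simp add: subst_op_empty[OF g])
qed

text \<open>On functions of the variables in \<open>J\<close> the average \<open>C J\<close> acts
  trivially, while substitution removes the substituted variables. This supplies the hypothesis of
  \<open>H_eq_R_C\<close>.\<close>

lemma H_eq_R:
  assumes J: "J \<subseteq> D" "J \<noteq> {}" and IH: "\<And>K. K \<subset> J \<Longrightarrow> decomposes K" and g: "g \<in> VV J"
  shows "H J g = R J g"
proof -
  have "C J (S J' g) \<in> VV (J - J')" if "J' \<subseteq> J" for J'
  proof -
    have S: "S J' g \<in> VV (J - J')" by (rule S_in_V[OF _ g]) (use that J in auto)
    then have "S J' g \<in> VV J" using V_mono[of "J - J'" J] by blast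
    from C_fixes_V[OF J(1) this] S show ?thesis by simp
  qed
  from H_eq_R_C[OF J IH VV_D[OF J(1) g] this] show ?thesis
    by (simp add: C_fixes_V[OF J(1) g])
qed

text \<open>Strong induction on the size of \<open>J\<close>. Once \<open>H J g = R J g\<close> is
  known, \<open>H J g\<close> is exactly what the proper subsets leave over from \<open>g\<close>;
  for empty \<open>J\<close>, averaging fixes constants.\<close>

lemma decomposition: "J \<subseteq> D \<Longrightarrow> decomposes J"
proof (induction "card J" arbitrary: J rule: less_induct)
  case less
  have IH: "decomposes K" if "K \<subset> J" for K
    using less that psubset_card_mono[OF finite_subset_D[OF less.prems] that] by auto
  show ?case
    unfolding decomposes_def
  proof
    fix g assume g: "g \<in> VV J"
    show "(\<lambda>x. \<Sum>J'\<in>Pow J. H J' g x) = g"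
    proof (cases "J = {}")
      case True
      have "H {} g = g"
        using g P.C_fixes_V[of "{}" g] H_empty_eq[OF VV_D[OF less.prems g]] by (simp add: True)
      then show ?thesis by (simp add: True)
    next
      case False
      show ?thesis
        using H_eq_R[OF less.prems False IH g]
        by (simp add: sum_Pow_psubset[OF finite_subset_D[OF less.prems]] R_def fun_eq_iff)
    qed
  qed
qed

lemma H_eq_R_V:
  assumes "J \<subseteq> D" "J \<noteq> {}" "g \<in> VV J"
  shows "H J g = R J g"
  by (rule H_eq_R) (use assms decomposition in auto)

text \<open>Idempotence and orthogonality are joined because the induction on the size of
  \<open>J\<close> needs both for smaller sets. For \<open>J'\<close> not inside \<open>J\<close>
  relevance suffices; a proper subset is handled by cancellation in \<open>R J\<close>, and
  \<open>J' = J\<close> by lean decomposability.\<close>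

lemma H_orthogonal:
  "J \<subseteq> D \<Longrightarrow> J' \<subseteq> D \<Longrightarrow> g \<in> VV D \<Longrightarrow> H J' (H J g) = (if J' = J then H J g else (\<lambda>x. 0))"
proof (induction "card J" arbitrary: J J' g rule: less_induct)
  case less
  note J = less.prems(1) and g = less.prems(3)
  have IH: "H K' (H K f) = (if K' = K then H K f else (\<lambda>x. 0))"
    if "K \<subset> J" "K' \<subseteq> D" "f \<in> VV D" for K K' f
    using less.hyps[OF psubset_card_mono[OF finite_subset_D[OF J] that(1)]] that J by auto
  have HJ: "H J g \<in> VV J" by (rule H_in_V[OF J g])
  have 0: "H K (H J g) = (\<lambda>x. 0)" if K: "K \<subset> J" for K
  proof -
    define f where "f = L J g"
    have f: "f \<in> VV D" unfolding f_def by (rule VV_D[OF J L_in_V[OF J g]])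
    have KD: "K \<subseteq> D" using K J by auto
    have "(\<lambda>x. \<Sum>I\<in>{I. I \<subset> J}. 1 * H I f x) \<in> VV D"
      by (rule V_sum[OF finite_psubsets[OF J]]) (use J f H_in_VD in auto)
    then have "H K (R J f) = (\<lambda>x. H K f x - H K (\<lambda>x. \<Sum>I\<in>{I. I \<subset> J}. 1 * H I f x) x)"
      unfolding R_def using linear_operator_diff[OF H_linear[OF KD] f] by simp
    also have "H K (\<lambda>x. \<Sum>I\<in>{I. I \<subset> J}. 1 * H I f x) = (\<lambda>x. \<Sum>I\<in>{I. I \<subset> J}. 1 * H K (H I f) x)"
      by (rule linear_operator_sum[OF H_linear[OF KD] finite_psubsets[OF J]])
        (use J f H_in_VD in auto)
    \<comment> \<open>By the induction hypothesis only \<open>I = K\<close> survives; this index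
      occurs because \<open>K\<close> is a proper subset of \<open>J\<close>, and its term cancels
      the leading \<open>H K f\<close>.\<close>
    also have "\<dots> = (\<lambda>x. \<Sum>I\<in>{I. I \<subset> J}. if K = I then H K f x else 0)"
      using IH[OF _ KD f] by (intro ext sum.cong) auto
    also have "\<dots> = H K f" using K finite_psubsets[OF J] by auto
    finally have "H K (R J f) = (\<lambda>x. 0)" by simp
    moreover have "H J g = R J f" unfolding f_def by (rule H_R[OF J]) (use K in blast)
    ultimately show ?thesis by simp
  qed
  show ?case
  proof (cases "J' \<subseteq> J")
    case False
    then show ?thesis using H_vanishes[OF less.prems(2) J False HJ] by auto
  next
    case True
    have "(\<Sum>K\<in>{K. K \<subset> J}. H K (H J g) x) = 0" for x
      by (rule sum.neutral) (use 0 in simp)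
    \<comment> \<open>\<open>H J g\<close> lies in \<open>VV J\<close>, hence is the sum of its
      components; those of proper subsets vanish, which leaves \<open>H J (H J g)\<close>.\<close>
    then have "H J (H J g) x = H J g x" for x
      using decomposesD[OF decomposition[OF J] HJ, of x]
      by (simp add: sum_Pow_psubset[OF finite_subset_D[OF J]])
    then show ?thesis using True 0 by auto
  qed
qed

section \<open>Unconditional averages and consistency under independence\<close>

text \<open>The law averaged over does not vary with \<open>x\<close>, so averaging creates no new
  dependence. The conditional average \<open>C J\<close> may do so, since its kernel can depend on
  every variable in \<open>J\<close>.\<close>

lemma E_in_V_Int:
  assumes J: "J \<subseteq> D" and K: "K \<subseteq> D" and g: "g \<in> VV K"
  shows "E J g \<in> VV (J \<inter> K)"
proof -
  have EJ: "E J g \<in> VV J" by (rule E_in_V[OF J VV_D[OF K g]])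
  obtain B where B: "\<And>x. \<bar>E J g x\<bar> \<le> B" using V_bounded[OF EJ] by blast
  show ?thesis
  proof (rule V_I[where B = B])
    fix x y assume *: "x \<in> Pi\<^sub>E D Xs" "y \<in> Pi\<^sub>E D Xs" "\<And>j. j \<in> J \<inter> K \<Longrightarrow> x j = y j"
    have "(\<integral>\<omega>. g (merge J (D - J) (x, feature_vec X (D - J) \<omega>)) \<partial>M)
        = (\<integral>\<omega>. g (merge J (D - J) (y, feature_vec X (D - J) \<omega>)) \<partial>M)"
    proof (rule Bochner_Integration.integral_cong[OF refl])
      fix \<omega> assume \<omega>: "\<omega> \<in> space M"
      have F: "feature_vec X (D - J) \<omega> \<in> Pi\<^sub>E (D - J) Xs" by (rule feature_vec_PiE[OF _ \<omega>]) auto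
      have "x \<in> Pi J Xs" "y \<in> Pi J Xs" using * J by auto
      from V_depends[OF g merge_PiE[OF J this(1) F] merge_PiE[OF J this(2) F]]
      show "g (merge J (D - J) (x, feature_vec X (D - J) \<omega>))
          = g (merge J (D - J) (y, feature_vec X (D - J) \<omega>))"
        using * by (auto simp: merge_def)
    qed
    then show "E J g x = E J g y" using * by (simp add: expect_out_def on_dom_def)
  qed (use B V_measurable[OF EJ] V_outside[OF EJ] in auto)
qed

text \<open>Since \<open>X j\<close> takes its values in \<open>Xs j\<close>, preimages under the
  restricted sigma-algebra are already preimages of Borel sets, so independence carries over; it
  then passes to disjoint groups of variables.\<close>

lemma indep_feature_vecs:
  assumes "indep_vars (\<lambda>_. borel) X D" "A \<subseteq> D" "B \<subseteq> D" "A \<inter> B = {}"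
  shows "indep_var (FS A) (feature_vec X A) (FS B) (feature_vec X B)"
proof (rule indep_var_restrict[OF _ assms(4,2,3)])
  show "indep_vars (\<lambda>j. restrict_space borel (Xs j)) X D"
    unfolding indep_vars_def2
  proof (intro conjI ballI)
    show "random_variable (restrict_space borel (Xs j)) (X j)" if "j \<in> D" for j
      using that by (intro measurable_restrict_space2) (auto simp: X_range X_measurable)
    have "indep_sets (\<lambda>j. {X j -` A \<inter> space M |A. A \<in> sets borel}) D"
      using assms(1) unfolding indep_vars_def2 by (rule conjunct2)
    then show "indep_sets (\<lambda>j. {X j -` A \<inter> space M |A. A \<in> sets (restrict_space borel (Xs j))}) D"
    proof (rule indep_sets_mono_sets)
      fix j assume j: "j \<in> D"
      have "X j -` (Xs j \<inter> A) \<inter> space M = X j -` A \<inter> space M" for A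
        using X_range[OF j] by auto
      then show "{X j -` A \<inter> space M |A. A \<in> sets (restrict_space borel (Xs j))}
          \<subseteq> {X j -` A \<inter> space M |A. A \<in> sets borel}"
        unfolding sets_restrict_space by (clarsimp simp del: vimage_Int) blast
    qed
  qed
qed

text \<open>The left side draws the coordinates in \<open>J - K\<close> and those outside
  \<open>J\<close> separately, the right side draws them together; independence makes the two
  agree.\<close>

lemma E_tower:
  assumes ind: "indep_vars (\<lambda>_. borel) X D" and K: "K \<subseteq> J" and J: "J \<subseteq> D" and g: "g \<in> VV D"
  shows "E K (E J g) = E K g"
proof
  fix x
  show "E K (E J g) x = E K g x"
  proof (cases "x \<in> Pi\<^sub>E D Xs")
    case x: True
    define A where "A = J - K"
    define B where "B = D - J"
    have KD: "K \<subseteq> D" using K J by auto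
    have AB: "A \<subseteq> D" "B \<subseteq> D" "A \<inter> B = {}" "A \<union> B = D - K"
      using K J by (auto simp: A_def B_def)
    define \<Phi> where "\<Phi> = (\<lambda>z. g (merge K (D - K) (x, merge A B z)))"
    obtain b where b: "\<And>x. \<bar>g x\<bar> \<le> b" using V_bounded[OF g] by blast
    have "merge A B \<in> FS A \<Otimes>\<^sub>M FS B \<rightarrow>\<^sub>M FS (D - K)"
      using measurable_merge[of A B "\<lambda>j. restrict_space borel (Xs j)"] by (simp add: AB(4))
    from measurable_compose[OF this merge_section_measurable[OF KD x g]]
    have \<Phi>: "\<Phi> \<in> borel_measurable (FS A \<Otimes>\<^sub>M FS B)" by (simp add: \<Phi>_def)
    have 1: "merge K (D - K) (x, feature_vec X (D - K) \<omega>)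
        = merge K (D - K) (x, merge A B (feature_vec X A \<omega>, feature_vec X B \<omega>))" for \<omega>
      using AB by (auto simp: merge_def fun_eq_iff)
    \<comment> \<open>The inner draw overwrites the coordinates outside \<open>J\<close>, so of the
      outer draw only the part on \<open>A\<close> remains.\<close>
    have 2: "merge J (D - J) (merge K (D - K) (x, feature_vec X (D - K) \<omega>), feature_vec X (D - J) \<omega>')
        = merge K (D - K) (x, merge A B (feature_vec X A \<omega>, feature_vec X B \<omega>'))" for \<omega> \<omega>'
      using K J by (auto simp: merge_def fun_eq_iff A_def B_def)
    have "E K (E J g) x = (\<integral>\<omega>. \<integral>\<omega>'. \<Phi> (feature_vec X A \<omega>, feature_vec X B \<omega>') \<partial>M \<partial>M)"
    proof -
      have "E J g (merge K (D - K) (x, feature_vec X (D - K) \<omega>))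
          = (\<integral>\<omega>'. \<Phi> (feature_vec X A \<omega>, feature_vec X B \<omega>') \<partial>M)" if \<omega>: "\<omega> \<in> space M" for \<omega>
      proof -
        have "merge K (D - K) (x, feature_vec X (D - K) \<omega>) \<in> Pi\<^sub>E D Xs"
          by (rule merge_PiE[OF KD _ feature_vec_PiE[OF _ \<omega>]]) (use x KD in auto)
        then show ?thesis
          unfolding expect_out_def on_dom_def \<Phi>_def 2 by simp
      qed
      then show ?thesis
        using x unfolding expect_out_def[of M D Xs X K] on_dom_def
        by (simp cong: Bochner_Integration.integral_cong)
    qed
    also have "\<dots> = (\<integral>\<omega>. \<Phi> (feature_vec X A \<omega>, feature_vec X B \<omega>) \<partial>M)"
      by (rule indep_var_integral_iterated[OF indep_feature_vecs[OF ind AB(1,2,3)] \<Phi>, where B = b])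
        (simp add: \<Phi>_def b)
    also have "\<dots> = E K g x"
      using x unfolding expect_out_def on_dom_def \<Phi>_def 1 by simp
    finally show ?thesis .
  qed (simp add: expect_out_def on_dom_def)
qed

lemma C_eq_E:
  assumes ind: "indep_vars (\<lambda>_. borel) X D" and J: "J \<subseteq> D" and g: "g \<in> VV D"
  shows "C J g = E J g"
proof
  fix x
  show "C J g x = E J g x"
  proof (cases "x \<in> Pi\<^sub>E D Xs")
    case x: True
    have "\<kappa> J (restrict x J) = marginal J (restrict x J)"
      unfolding marginal_def by (rule \<kappa>_indep[OF ind J restrict_PiE_subset[OF J x]])
    then show ?thesis unfolding E_eq_P[OF J g] C_def P.C_def on_dom_def by simp
  qed (simp add: C_def expect_out_def on_dom_def)
qed

text \<open>Under independence \<open>C J\<close> coincides with \<open>E J\<close>, so averages of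
  substituted functions lose the substituted variables for every \<open>g\<close> in
  \<open>VV D\<close>. For nonempty \<open>J\<close>, \<open>H_eq_R_C\<close> then gives
  \<open>H J g = R J (E J g)\<close>, and \<open>R J\<close> agrees with \<open>H J\<close> on
  \<open>VV J\<close>.\<close>

lemma H_E:
  assumes ind: "indep_vars (\<lambda>_. borel) X D" and J: "J \<subseteq> D" and g: "g \<in> VV D"
  shows "H J (E J g) = H J g"
proof (cases "J = {}")
  case True
  then show ?thesis
    using H_orthogonal[of "{}" "{}", OF _ _ g] by (simp add: E_empty H_empty[symmetric])
next
  case False
  have "C J (S J' g) \<in> VV (J - J')" if "J' \<subseteq> J" for J'
  proof -
    have J': "J' \<subseteq> D" using that J by auto
    have "C J (S J' g) = E J (S J' g)" by (rule C_eq_E[OF ind J S_in_VD[OF J' g]])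
    also have "\<dots> \<in> VV (J \<inter> (D - J'))" by (rule E_in_V_Int[OF J _ S_in_V[OF J' g]]) auto
    also have "J \<inter> (D - J') = J - J'" using J by auto
    finally show ?thesis .
  qed
  from H_eq_R_C[OF J False decomposition g this]
  have "H J g = R J (C J g)" using J by auto
  also have "\<dots> = R J (E J g)" by (simp add: C_eq_E[OF ind J g])
  also have "\<dots> = H J (E J g)" by (rule H_eq_R_V[OF J False E_in_V[OF J g], symmetric])
  finally show ?thesis by simp
qed

text \<open>By \<open>H_E\<close>, \<open>H J'\<close> sees \<open>g\<close> only through
  \<open>E J' g\<close>, which by the tower property is unchanged when \<open>g\<close> is replaced
  by \<open>E J g\<close>. The latter lies in \<open>VV J\<close>, where the components add up to
  the function.\<close>

lemma sum_H_eq_E: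
  assumes ind: "indep_vars (\<lambda>_. borel) X D" and J: "J \<subseteq> D" and g: "g \<in> VV D"
  shows "(\<lambda>x. \<Sum>J'\<in>Pow J. H J' g x) = E J g"
proof -
  have "H J' g = H J' (E J g)" if "J' \<in> Pow J" for J'
  proof -
    have J': "J' \<subseteq> J" "J' \<subseteq> D" using that J by auto
    have "H J' (E J g) = H J' (E J' (E J g))"
      by (rule H_E[OF ind J'(2) VV_D[OF J E_in_V[OF J g]], symmetric])
    also have "\<dots> = H J' (E J' g)" by (simp add: E_tower[OF ind J'(1) J g])
    also have "\<dots> = H J' g" by (rule H_E[OF ind J'(2) g])
    finally show ?thesis by simp
  qed
  then have "(\<Sum>J'\<in>Pow J. H J' g x) = (\<Sum>J'\<in>Pow J. H J' (E J g) x)" for x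
    by (intro sum.cong) auto
  then show ?thesis
    using decomposesD[OF decomposition[OF J] E_in_V[OF J g]] by auto
qed

section \<open>Collecting the properties of an interaction decomposition\<close>

lemma H_interaction_decomposition: "interaction_decomposition M D Xs X H"
  unfolding interaction_decomposition_def
proof (intro conjI allI impI ballI)
  fix J assume J: "J \<subseteq> D"
  show "linear_operator (VV D) (VV J) (H J)" by (rule H_linear[OF J])
  show "expect M D Xs X (H J g) = (\<lambda>x. 0)" if "J \<noteq> {}" "g \<in> VV D" for g
    using H_orthogonal[OF J _ that(2), of "{}"] that(1) by (simp add: H_empty)
  show "H J g = (\<lambda>x. 0)" if "g \<in> VV D" "partial_zero D Xs J g" for g
    by (rule H_relevance[OF J that])
  show "(\<lambda>x. \<Sum>J'\<in>Pow J. H J' g x) = g" if "g \<in> VV J" for g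
    using decomposesD[OF decomposition[OF J] that] by auto
  show "H J (H J g) = H J g" if "g \<in> VV D" for g
    using H_orthogonal[OF J J that] by simp
  show "H J' (H J g) = (\<lambda>x. 0)" if "J' \<subseteq> D" "J' \<noteq> J" "g \<in> VV D" for J' g
    using H_orthogonal[OF J that(1,3)] that(2) by simp
  show "(\<lambda>x. \<Sum>J'\<in>Pow J. H J' g x) = E J g"
    if "indep_vars (\<lambda>_. borel) X D" "g \<in> VV D" for g
    by (rule sum_H_eq_E[OF that(1) J that(2)])
qed (rule H_empty)

end

theorem proposition9:
  fixes M :: "'w measure"
    and d :: nat
    and D :: "nat set"
    and Xs :: "nat \<Rightarrow> real set"
    and X :: "nat \<Rightarrow> 'w \<Rightarrow> real"
    and \<kappa> :: "nat set \<Rightarrow> (nat \<Rightarrow> real) \<Rightarrow> (nat \<Rightarrow> real) measure"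
    and r :: "nat \<Rightarrow> real"
  assumes "prob_space M"
    and "d \<ge> 1" and "D = {1..d}"
    and "\<And>j. j \<in> D \<Longrightarrow> compact (Xs j) \<and> Xs j \<noteq> {}"
    and "\<And>j. j \<in> D \<Longrightarrow> X j \<in> borel_measurable M"
    and "\<And>j \<omega>. j \<in> D \<Longrightarrow> \<omega> \<in> space M \<Longrightarrow> X j \<omega> \<in> Xs j"
    and "\<And>J. J \<subseteq> D \<Longrightarrow> regular_cond_distr M D Xs X J (\<kappa> J)"
    and "\<And>J x. prob_space.indep_vars M (\<lambda>_. borel) X D \<Longrightarrow> J \<subseteq> D \<Longrightarrow> x \<in> Pi\<^sub>E J Xs
           \<Longrightarrow> \<kappa> J x = distr M (feature_space Xs (D - J)) (feature_vec X (D - J))"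
    and "\<And>j. j \<in> D \<Longrightarrow> r j \<in> Xs j"
  shows "interaction_decomposition M D Xs X (H_CE M D Xs X \<kappa> r)"
proof -
  interpret prob_space M by fact
  have "ce_setting M D Xs X \<kappa> r"
  proof
    show "\<kappa> J \<in> feature_space Xs J \<rightarrow>\<^sub>M prob_algebra (feature_space Xs (D - J))" if "J \<subseteq> D" for J
      using assms(7)[OF that] unfolding regular_cond_distr_def by (rule conjunct1)
  qed (use assms in auto)
  then show ?thesis by (rule ce_setting.H_interaction_decomposition)
qed

end
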